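(* There is an efficient algorithm that takes as input an integer $k \geq 2$ and any $p \geq 1$ and either fails or outputs $V \in \mathbb{R}^{2^k \times k}$ and $\vec{t}^* \in \mathbb{R}^{2^k}$ that define a $(p,k)$-isolating parallelepiped. Furthermore, for any fixed $k \geq 2$, the algorithm only fails on finitely many values of $p \geq 1$.
   Context: $V\in\mathbb{R}^{d^*\times k}$ and $\vec t^*\in\mathbb{R}^{d^*}$ define a $(p,k)$-isolating parallelepiped if $\|\vec t^*\|_p>1$ and $\|V\vec x-\vec t^*\|_p=1$ for all $\vec x\in\{0,1\}^k\setminus\{\vec 0_k\}$, where $\|\vec x\|_p=(\sum_i|x_i|^p)^{1/p}$. *)

theory Defs
  imports Complex_Main "Jordan_Normal_Form.Matrix"
begin

definition lp_norm :: "real \<Rightarrow> real vec \<Rightarrow> real" where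
  "lp_norm p x = (\<Sum>i<dim_vec x. \<bar>x $ i\<bar> powr p) powr (1 / p)"

definition zero_one_vecs :: "nat \<Rightarrow> real vec set" where
  "zero_one_vecs k = {x \<in> carrier_vec k. \<forall>i<k. x $ i \<in> {0, 1}}"

definition isolating_parallelepiped ::
    "real \<Rightarrow> nat \<Rightarrow> real mat \<Rightarrow> real vec \<Rightarrow> bool" where
  "isolating_parallelepiped p k V t \<longleftrightarrow>
     V \<in> carrier_mat (dim_vec t) k \<and>
     lp_norm p t > 1 \<and>
     (\<forall>x \<in> zero_one_vecs k - {0\<^sub>v k}. lp_norm p (V *\<^sub>v x - t) = 1)"

text \<open>
  Algorithms on real data are programs of a real RAM, given as a small while language.
  The memory consists of arrays of natural numbers and arrays of reals; array names are literals
  in the program text, indices are computed, so a program uses finitely many arrays of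
  unbounded length.  As usual for a real RAM, arithmetic and comparison of reals are exact and
  there is no rounding operation from reals to integers.  Real powers are primitive, because the
  exponent \<open>p\<close> is an arbitrary real number.  The only constants are natural number literals: an
  arbitrary real constant could encode an infinite amount of advice.
  Natural numbers serve for indexing and counting and have only (truncated) subtraction and
  addition.
\<close>

datatype iexp =
    INat nat
  | ILoad nat iexp
  | IAdd iexp iexp
  | ISub iexp iexp

datatype rexp =
    RNat iexp
  | RLoad nat iexp
  | RAdd rexp rexp
  | RSub rexp rexp
  | RMul rexp rexp
  | RDiv rexp rexp
  | RPow rexp rexp

datatype bexp =
    ILess iexp iexp
  | RLess rexp rexp
  | BNot bexp
  | BAnd bexp bexp

datatype com =
    Skip
  | IStore nat iexp iexp
  | RStore nat iexp rexp
  | Seq com com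
  | Cond bexp com com
  | Loop bexp com
  | Fail

type_synonym state = "(nat \<Rightarrow> nat \<Rightarrow> nat) \<times> (nat \<Rightarrow> nat \<Rightarrow> real)"

fun ival :: "iexp \<Rightarrow> state \<Rightarrow> nat" where
  "ival (INat n) s = n"
| "ival (ILoad a e) s = fst s a (ival e s)"
| "ival (IAdd e f) s = ival e s + ival f s"
| "ival (ISub e f) s = ival e s - ival f s"

text \<open>
  All operations are total: \<open>x / 0 = 0\<close>, and the power operation computes \<open>\<bar>x\<bar>\<^sup>y\<close>
  with value \<open>0\<close> at \<open>x = 0\<close>.
\<close>

fun rval :: "rexp \<Rightarrow> state \<Rightarrow> real" where
  "rval (RNat e) s = real (ival e s)"
| "rval (RLoad a e) s = snd s a (ival e s)"
| "rval (RAdd e f) s = rval e s + rval f s"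
| "rval (RSub e f) s = rval e s - rval f s"
| "rval (RMul e f) s = rval e s * rval f s"
| "rval (RDiv e f) s = rval e s / rval f s"
| "rval (RPow e f) s = \<bar>rval e s\<bar> powr rval f s"

fun bval :: "bexp \<Rightarrow> state \<Rightarrow> bool" where
  "bval (ILess e f) s \<longleftrightarrow> ival e s < ival f s"
| "bval (RLess e f) s \<longleftrightarrow> rval e s < rval f s"
| "bval (BNot b) s \<longleftrightarrow> \<not> bval b s"
| "bval (BAnd b c) s \<longleftrightarrow> bval b s \<and> bval c s"

text \<open>Unit cost: every literal, memory access, operation and comparison takes one step.\<close>

fun icost :: "iexp \<Rightarrow> nat" where
  "icost (INat n) = 1"
| "icost (ILoad a e) = icost e + 1"
| "icost (IAdd e f) = icost e + icost f + 1"
| "icost (ISub e f) = icost e + icost f + 1"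

fun rcost :: "rexp \<Rightarrow> nat" where
  "rcost (RNat e) = icost e + 1"
| "rcost (RLoad a e) = icost e + 1"
| "rcost (RAdd e f) = rcost e + rcost f + 1"
| "rcost (RSub e f) = rcost e + rcost f + 1"
| "rcost (RMul e f) = rcost e + rcost f + 1"
| "rcost (RDiv e f) = rcost e + rcost f + 1"
| "rcost (RPow e f) = rcost e + rcost f + 1"

fun bcost :: "bexp \<Rightarrow> nat" where
  "bcost (ILess e f) = icost e + icost f + 1"
| "bcost (RLess e f) = rcost e + rcost f + 1"
| "bcost (BNot b) = bcost b + 1"
| "bcost (BAnd b c) = bcost b + bcost c + 1"

definition upd :: "(nat \<Rightarrow> nat \<Rightarrow> 'a) \<Rightarrow> nat \<Rightarrow> nat \<Rightarrow> 'a \<Rightarrow> nat \<Rightarrow> nat \<Rightarrow> 'a" where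
  "upd m a i x = m(a := (m a)(i := x))"

text \<open>
  \<open>exec c s n r\<close>: started in \<open>s\<close>, program \<open>c\<close> halts after exactly \<open>n\<close> steps with result \<open>r\<close>,
  where \<open>None\<close> means that it reported failure and \<open>Some s'\<close> that it ended normally in \<open>s'\<close>.
  A diverging run has no result.
\<close>

inductive exec :: "com \<Rightarrow> state \<Rightarrow> nat \<Rightarrow> state option \<Rightarrow> bool" where
  Skip: "exec Skip s 1 (Some s)"
| IStore: "exec (IStore a e f) s (icost e + icost f + 1)
    (Some (upd (fst s) a (ival e s) (ival f s), snd s))"
| RStore: "exec (RStore a e f) s (icost e + rcost f + 1)
    (Some (fst s, upd (snd s) a (ival e s) (rval f s)))"
| Seq: "exec c s m (Some s') \<Longrightarrow> exec d s' n r \<Longrightarrow> exec (Seq c d) s (m + n) r"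
| SeqFail: "exec c s m None \<Longrightarrow> exec (Seq c d) s m None"
| CondTrue: "bval b s \<Longrightarrow> exec c s n r \<Longrightarrow> exec (Cond b c d) s (bcost b + n) r"
| CondFalse: "\<not> bval b s \<Longrightarrow> exec d s n r \<Longrightarrow> exec (Cond b c d) s (bcost b + n) r"
| LoopEnd: "\<not> bval b s \<Longrightarrow> exec (Loop b c) s (bcost b) (Some s)"
| LoopStep: "bval b s \<Longrightarrow> exec c s m (Some s') \<Longrightarrow> exec (Loop b c) s' n r \<Longrightarrow>
    exec (Loop b c) s (bcost b + m + n) r"
| LoopFail: "bval b s \<Longrightarrow> exec c s m None \<Longrightarrow> exec (Loop b c) s (bcost b + m) None"
| Fail: "exec Fail s 1 None"

inductive_cases exec_SkipE: "exec Skip s n r"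
inductive_cases exec_IStoreE: "exec (IStore a e f) s n r"
inductive_cases exec_RStoreE: "exec (RStore a e f) s n r"
inductive_cases exec_SeqE: "exec (Seq c d) s n r"
inductive_cases exec_CondE: "exec (Cond b c d) s n r"
inductive_cases exec_LoopE: "exec (Loop b c) s n r"
inductive_cases exec_FailE: "exec Fail s n r"

lemma exec_deterministic:
  "exec c s n r \<Longrightarrow> exec c s n' r' \<Longrightarrow> n' = n \<and> r' = r"
proof (induction arbitrary: n' r' rule: exec.induct)
  case Skip
  then show ?case by (auto elim: exec_SkipE)
next
  case IStore
  then show ?case by (auto elim: exec_IStoreE)
next
  case RStore
  then show ?case by (auto elim: exec_RStoreE)
next
  case Seq
  from Seq.prems show ?case by (rule exec_SeqE) (use Seq.IH in blast)+
next
  case SeqFail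
  from SeqFail.prems show ?case by (rule exec_SeqE) (use SeqFail.IH in blast)+
next
  case CondTrue
  from CondTrue.prems show ?case by (rule exec_CondE) (use CondTrue.IH CondTrue.hyps in blast)+
next
  case CondFalse
  from CondFalse.prems show ?case by (rule exec_CondE) (use CondFalse.IH CondFalse.hyps in blast)+
next
  case LoopEnd
  from LoopEnd.prems show ?case by (rule exec_LoopE) (use LoopEnd.hyps in blast)+
next
  case LoopStep
  from LoopStep.prems show ?case by (rule exec_LoopE) (use LoopStep.IH LoopStep.hyps in blast)+
next
  case LoopFail
  from LoopFail.prems show ?case by (rule exec_LoopE) (use LoopFail.IH LoopFail.hyps in blast)+
next
  case Fail
  then show ?case by (auto elim: exec_FailE)
qed

text \<open>
  Calling convention: the inputs are cell 0 of integer array 0 and of real array 0,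
  and all other memory is zero.  The output matrix is read from real array 1 in row-major order,
  the output vector from real array 2.
\<close>

definition input_state :: "nat \<Rightarrow> real \<Rightarrow> state" where
  "input_state k p = (upd (\<lambda>_ _. 0) 0 0 k, upd (\<lambda>_ _. 0) 0 0 p)"

definition output_mat :: "nat \<Rightarrow> nat \<Rightarrow> state \<Rightarrow> real mat" where
  "output_mat d k s = mat d k (\<lambda>(i, j). snd s 1 (i * k + j))"

definition output_vec :: "nat \<Rightarrow> state \<Rightarrow> real vec" where
  "output_vec d s = vec d (\<lambda>i. snd s 2 i)"

definition fails_on :: "com \<Rightarrow> nat \<Rightarrow> real \<Rightarrow> bool" where
  "fails_on A k p \<longleftrightarrow> (\<exists>n. exec A (input_state k p) n None)"

definition outputs_on :: "com \<Rightarrow> nat \<Rightarrow> real \<Rightarrow> real mat \<Rightarrow> real vec \<Rightarrow> bool" where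
  "outputs_on A k p V t \<longleftrightarrow>
     (\<exists>n s. exec A (input_state k p) n (Some s) \<and>
        V = output_mat (2 ^ k) k s \<and> t = output_vec (2 ^ k) s)"

text \<open>
  The output consists of \<open>2\<^sup>k (k + 1)\<close> reals, so efficiency means that the number of steps is
  polynomial in \<open>2\<^sup>k\<close>.  The bound does not depend on \<open>p\<close>.
\<close>

definition efficient :: "com \<Rightarrow> bool" where
  "efficient A \<longleftrightarrow> (\<exists>C c :: nat. \<forall>k\<ge>2. \<forall>p\<ge>1.
     \<exists>n r. exec A (input_state k p) n r \<and> n \<le> C * (2 ^ k) ^ c)"

end

theory Submission
  imports Defs "HOL-Library.Nat_Bijection"
begin

text \<open>
  The rows are indexed by the subsets \<open>U\<close> of \<open>{0..<k}\<close>, and row \<open>U\<close> is chosen such that the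
  corresponding entry of \<open>V x - t\<close> is a scaled Hamming distance \<open>d(U, x)\<close>.  Hence
  \<open>\<parallel>V x - t\<parallel>\<^sub>p\<^sup>p = \<Sum>\<^sub>U w(U) d(U, x)\<^sup>p\<close> with arbitrary weights \<open>w \<ge> 0\<close>.  This is a convolution on the
  group \<open>(\<int>/2)\<^sup>k\<close>, so the Walsh transform diagonalises it: if every Fourier coefficient \<open>H(S)\<close> of
  \<open>U \<mapsto> |U|\<^sup>p\<close> is nonzero, then the weights with Fourier coefficients \<open>1 / H(S)\<close> yield a multiple of
  the indicator function of \<open>x = 0\<close>, up to a constant that the coefficient at \<open>S = {}\<close> makes
  positive.  That coefficient also makes all weights positive.

  The coefficient \<open>H(S)\<close> is a sum of finite differences of order \<open>|S|\<close> of \<open>x \<mapsto> x\<^sup>p\<close>.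
  By the mean value theorem it vanishes only if \<open>p(p - 1)\<cdots>(p - |S| + 1) = 0\<close>, so it suffices
  to fail on the integers \<open>p < k\<close>.
\<close>

section \<open>Fourier coefficients of the Hamming distance\<close>

lemma sum_Pow_insert:
  assumes "finite K" "a \<notin> K"
  shows "(\<Sum>U\<in>Pow (insert a K). f U) = (\<Sum>U\<in>Pow K. f U) + (\<Sum>U\<in>Pow K. f (insert a U))"
proof -
  have "inj_on (insert a) (Pow K)"
    using assms(2) by (auto simp: inj_on_def)
  moreover have "Pow K \<inter> insert a ` Pow K = {}"
    using assms(2) by auto
  ultimately show ?thesis
    using assms(1) by (simp add: Pow_insert sum.union_disjoint sum.reindex)
qed

text \<open>Induction on \<open>S\<close>. Splitting the subsets by membership of \<open>a\<close>
  turns the sum into a difference of one function at \<open>x\<close> and \<open>x + 1\<close>, and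
  its derivative is \<open>p\<close> times the sum for the smaller \<open>S\<close> with exponent
  \<open>p - 1\<close>. The shift \<open>x\<close> is general because the mean value theorem gives
  no control over the intermediate point; \<open>T\<close> holds the elements that carry no
  sign.\<close>

lemma alternating_powr_sum_nonzero:
  fixes p x :: real
  assumes "finite S" "finite T" "S \<inter> T = {}" "\<forall>i<card S. p \<noteq> real i"
    and "x > 0 \<or> x = 0 \<and> p > 0 \<and> S \<union> T \<noteq> {}"
  shows "(\<Sum>U\<in>Pow (S \<union> T). (- 1) ^ card (U \<inter> S) * (x + real (card U)) powr p) \<noteq> 0"
  using assms(1,3-5)
proof (induction S arbitrary: p x rule: finite_induct)
  case empty
  \<comment> \<open>No signs are left: all terms are nonnegative, and the one for
    \<open>U = T\<close> is positive, even at \<open>x = 0\<close>, where \<open>T\<close> is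
    nonempty.\<close>
  have "(\<Sum>U\<in>Pow T. (x + real (card U)) powr p) > 0"
  proof (rule sum_pos2)
    show "T \<in> Pow T" by simp
    show "0 < (x + real (card T)) powr p"
      using empty.prems \<open>finite T\<close> by (auto simp: card_gt_0_iff add_pos_nonneg)
  qed (use \<open>finite T\<close> in auto)
  then show ?case by simp
next
  case (insert a S)
  define K where "K = S \<union> T"
  have K: "finite K" "a \<notin> K" "insert a S \<union> T = insert a K"
    using insert \<open>finite T\<close> by (auto simp: K_def)
  define g where "g q y = (\<Sum>U\<in>Pow K. (- 1) ^ card (U \<inter> S) * (y + real (card U)) powr q)"
    for q y :: real
  have "(\<Sum>U\<in>Pow (insert a S \<union> T). (- 1) ^ card (U \<inter> insert a S) * (x + real (card U)) powr p)
      = g p x - g p (x + 1)"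
  proof -
    have fU: "finite U" "a \<notin> U" if "U \<subseteq> K" for U
      using that K by (auto intro: finite_subset)
    have "card (U \<inter> insert a S) = card (U \<inter> S)" if "U \<subseteq> K" for U
      using fU[OF that] by simp
    moreover have "card (insert a U \<inter> insert a S) = Suc (card (U \<inter> S))" if "U \<subseteq> K" for U
    proof -
      have "insert a U \<inter> insert a S = insert a (U \<inter> S)" by auto
      then show ?thesis using fU[OF that] by simp
    qed
    ultimately show ?thesis
      using fU unfolding K(3) sum_Pow_insert[OF K(1,2)]
      by (simp add: g_def add_ac sum_negf)
  qed
  moreover have "g p x - g p (x + 1) \<noteq> 0"
  proof -
    have x: "x \<ge> 0" using insert.prems by auto
    have p: "p \<noteq> 0" using insert by (auto simp: card_insert_if)
    have der: "(g p has_real_derivative p * g (p - 1) y) (at y)" if "y > 0" for y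
    proof -
      have "((\<lambda>y. (- 1) ^ card (U \<inter> S) * (y + real (card U)) powr p) has_real_derivative
          (- 1) ^ card (U \<inter> S) * (p * (y + real (card U)) powr (p - 1) * (1 + 0))) (at y)" for U
        using that
        by (intro DERIV_cmult DERIV_chain'[where g = "\<lambda>z. z powr p"] DERIV_add DERIV_ident DERIV_const
            has_real_derivative_powr) (simp add: add_pos_nonneg)
      then have "(g p has_real_derivative
          (\<Sum>U\<in>Pow K. (- 1) ^ card (U \<inter> S) * (p * (y + real (card U)) powr (p - 1) * (1 + 0)))) (at y)"
        unfolding g_def by (intro DERIV_sum)
      then show ?thesis by (simp add: g_def sum_distrib_left mult_ac)
    qed
    \<comment> \<open>At the left end \<open>x = 0\<close> the term for \<open>U = {}\<close> is
      \<open>y powr p\<close>, continuous there because then \<open>p > 0\<close>. Differentiability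
      is used only for \<open>y > 0\<close>.\<close>
    have "continuous_on {x..x + 1} (g p)"
      unfolding g_def
      by (intro continuous_intros continuous_on_powr' ballI) (use insert.prems in auto)
    from MVT[OF _ this] obtain l z where z: "x < z" "DERIV (g p) z :> l" "g p (x + 1) - g p x = l"
      using der x by (auto simp: real_differentiable_def) (metis less_eq_real_def order_le_less_trans)
    have "l = p * g (p - 1) z"
      using DERIV_unique[OF z(2) der] z x by simp
    \<comment> \<open>Since \<open>z > 0\<close>, the first alternative of the condition on
      \<open>x\<close> holds, so \<open>p - 1\<close> may be negative.\<close>
    moreover have "g (p - 1) z \<noteq> 0"
      unfolding g_def K_def
    proof (rule insert.IH)
      show "\<forall>i<card S. p - 1 \<noteq> real i"
      proof (intro allI impI notI)
        fix i assume "i < card S" "p - 1 = real i"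
        then have "p = real (Suc i)" "Suc i < card (insert a S)"
          using insert.hyps by auto
        then show False using insert.prems by blast
      qed
    qed (use insert.prems z x in auto)
    ultimately show ?thesis using z(3) p by auto
  qed
  ultimately show ?case by simp
qed

text \<open>Orthogonality of characters: the sum factors over the elements of \<open>K\<close>, and
  each element of \<open>B\<close> contributes the factor \<open>1 - 1 = 0\<close>.\<close>

lemma sum_sign_Pow:
  assumes "finite K" "B \<subseteq> K"
  shows "(\<Sum>A\<in>Pow K. (- 1) ^ card (A \<inter> B)) = (if B = {} then 2 ^ card K else (0 :: real))"
proof -
  have "(- 1) ^ card (A \<inter> B) = (\<Prod>a\<in>A. if a \<in> B then - 1 else (1 :: real))" if "A \<in> Pow K" for A
    using that assms by (simp add: prod.If_cases finite_subset)
  then have "(\<Sum>A\<in>Pow K. (- 1) ^ card (A \<inter> B)) = (\<Prod>a\<in>K. (if a \<in> B then - 1 else 1) + (1 :: real))"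
    using prod_add[OF assms(1), of "\<lambda>a. if a \<in> B then - 1 else 1" "\<lambda>_. 1 :: real"] by simp
  also have "\<dots> = (if B = {} then 2 ^ card K else 0)"
    using assms by (auto simp: prod_zero_iff)
  finally show ?thesis .
qed

text \<open>These signs are the characters of the group of subsets under symmetric difference: an
  element in both \<open>B\<close> and \<open>C\<close> contributes two signs that cancel.\<close>

lemma sign_sym_diff:
  assumes "finite A"
  shows "(- 1) ^ card (A \<inter> sym_diff B C) = (- 1) ^ card (A \<inter> B) * (- 1 :: real) ^ card (A \<inter> C)"
proof -
  have *: "(- 1) ^ card (A \<inter> B) = (\<Prod>a\<in>A. if a \<in> B then - 1 else (1 :: real))" for B
    using assms by (simp add: prod.If_cases)
  show ?thesis
    unfolding * prod.distrib[symmetric] by (rule prod.cong) auto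
qed

text \<open>The dictionary between row indices, used by the program, and subsets, used by the
  Fourier argument: a set bit \<open>i\<close> forces \<open>2 ^ i \<le> n\<close>, and all bits
  below \<open>k\<close> together give less than \<open>2 ^ k\<close>.\<close>

lemma bij_betw_set_decode: "bij_betw set_decode {..<2 ^ k} (Pow {..<k})"
proof (rule bij_betw_byWitness[where f' = set_encode])
  show "set_decode ` {..<2 ^ k} \<subseteq> Pow {..<k}"
  proof safe
    fix n i assume "n < (2 :: nat) ^ k" "i \<in> set_decode n"
    then have "n div 2 ^ i \<noteq> 0"
      by (auto simp: set_decode_def intro!: Nat.gr0I)
    then have "2 ^ i \<le> n" by (simp add: div_eq_0_iff)
    then have "(2 :: nat) ^ i < 2 ^ k" using \<open>n < 2 ^ k\<close> by (rule le_less_trans)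
    then show "i < k" by simp
  qed
  show "set_encode ` Pow {..<k} \<subseteq> {..<2 ^ k}"
  proof safe
    fix A assume "A \<subseteq> {..<k}"
    then have "set_encode A \<le> (\<Sum>i<k. 2 ^ i)"
      unfolding set_encode_def by (intro sum_mono2) auto
    also have "\<dots> < 2 ^ k" by (simp add: lessThan_atLeast0 sum_power2)
    finally show "set_encode A < 2 ^ k" .
  qed
qed (auto simp: finite_subset[OF _ finite_lessThan])

text \<open>Substituting \<open>sym_diff U X\<close> for \<open>U\<close> moves \<open>X\<close>
  from \<open>\<phi>\<close> into the characters. Swapping the sums then produces the products
  \<open>Y S * H S\<close>, so the convolution is diagonalised.\<close>

lemma walsh_weights:
  fixes H Y :: "'a set \<Rightarrow> real" and \<phi> :: "nat \<Rightarrow> real"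
  assumes K: "finite K" "X \<subseteq> K"
    and H: "\<And>S. H S = (\<Sum>U\<in>Pow K. (- 1) ^ card (S \<inter> U) * \<phi> (card U))"
    and Y: "\<And>S. S \<subseteq> K \<Longrightarrow> S \<noteq> {} \<Longrightarrow> Y S * H S = 1"
  shows "(\<Sum>U\<in>Pow K. (\<Sum>S\<in>Pow K. (- 1) ^ card (U \<inter> S) * Y S) * \<phi> (card (sym_diff U X)))
       = Y {} * H {} - 1 + (if X = {} then 2 ^ card K else 0)"
proof -
  have fin: "finite S" if "S \<subseteq> K" for S using that K(1) finite_subset by auto
  have "(\<Sum>U\<in>Pow K. (\<Sum>S\<in>Pow K. (- 1) ^ card (U \<inter> S) * Y S) * \<phi> (card (sym_diff U X)))
      = (\<Sum>U\<in>Pow K. (\<Sum>S\<in>Pow K. (- 1) ^ card (sym_diff U X \<inter> S) * Y S) * \<phi> (card U))"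
    by (rule sum.reindex_bij_witness[of _ "\<lambda>U. sym_diff U X" "\<lambda>U. sym_diff U X"])
       (use K in \<open>auto intro!: sum.cong arg_cong[where f = card] arg_cong2[where f = "(*)"] arg_cong[where f = \<phi>]
          arg_cong[where f = "\<lambda>n. (- 1) ^ n"]\<close>)
  also have "\<dots> = (\<Sum>U\<in>Pow K. \<Sum>S\<in>Pow K.
      (- 1) ^ card (S \<inter> X) * Y S * ((- 1) ^ card (S \<inter> U) * \<phi> (card U)))"
    by (intro sum.cong refl)
       (auto simp: sum_distrib_left sum_distrib_right fin sign_sym_diff Int_commute mult_ac intro!: sum.cong)
  also have "\<dots> = (\<Sum>S\<in>Pow K. (- 1) ^ card (S \<inter> X) * (Y S * H S))"
    by (subst sum.swap) (simp add: H sum_distrib_left mult_ac)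
  \<comment> \<open>All terms except \<open>S = {}\<close> have product 1; putting the empty set
    back completes a character sum, at the price of the summand -1.\<close>
  also have "\<dots> = Y {} * H {} + (\<Sum>S\<in>Pow K - {{}}. (- 1) ^ card (S \<inter> X))"
    using K by (subst sum.remove[of _ "{}"]) (auto simp: Y intro!: sum.cong)
  also have "(\<Sum>S\<in>Pow K - {{}}. (- 1) ^ card (S \<inter> X)) = (\<Sum>S\<in>Pow K. (- 1) ^ card (S \<inter> X)) - (1 :: real)"
    using K by (subst sum_diff1) auto
  also have "(\<Sum>S\<in>Pow K. (- 1) ^ card (S \<inter> X)) = (if X = {} then 2 ^ card K else (0 :: real))"
    using K by (rule sum_sign_Pow)
  finally show ?thesis by simp
qed

section \<open>Total correctness with step bounds\<close>

lemma upd_same [simp]: "upd m a i x a j = (if j = i then x else m a j)"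
  by (simp add: upd_def)

lemma upd_other [simp]: "a \<noteq> b \<Longrightarrow> upd m a i x b = m b"
  by (simp add: upd_def)

text \<open>A run that reports failure does not satisfy this, so failing runs are handled with
  \<open>exec\<close> directly.\<close>

definition tot :: "com \<Rightarrow> state \<Rightarrow> nat \<Rightarrow> (state \<Rightarrow> bool) \<Rightarrow> bool" where
  "tot c s B Q \<longleftrightarrow> (\<exists>n s'. exec c s n (Some s') \<and> n \<le> B \<and> Q s')"

text \<open>Determinism makes this an equivalence, so the simplifier can execute assignments
  symbolically.\<close>

lemma tot_exec:
  assumes "exec c s n (Some s')"
  shows "tot c s B Q \<longleftrightarrow> n \<le> B \<and> Q s'"
  unfolding tot_def using assms by (metis exec_deterministic option.inject)

lemmas tot_Skip [simp] = tot_exec[OF exec.Skip]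
lemmas tot_IStore [simp] = tot_exec[OF exec.IStore]
lemmas tot_RStore [simp] = tot_exec[OF exec.RStore]

lemma tot_mono: "tot c s B Q \<Longrightarrow> B \<le> B' \<Longrightarrow> (\<And>s'. Q s' \<Longrightarrow> Q' s') \<Longrightarrow> tot c s B' Q'"
  unfolding tot_def by (meson order_trans)

lemma tot_Seq:
  assumes "tot c s B1 P" "\<And>s'. P s' \<Longrightarrow> tot d s' B2 Q" "B1 + B2 \<le> B"
  shows "tot (Seq c d) s B Q"
proof -
  obtain m s1 where 1: "exec c s m (Some s1)" "m \<le> B1" "P s1"
    using assms(1) unfolding tot_def by blast
  obtain n s2 where 2: "exec d s1 n (Some s2)" "n \<le> B2" "Q s2"
    using assms(2)[OF 1(3)] unfolding tot_def by blast
  show ?thesis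
    unfolding tot_def using exec.Seq[OF 1(1) 2(1)] 1(2) 2 assms(3)
    by (intro exI[of _ "m + n"] exI[of _ s2]) simp
qed

text \<open>As a rewrite rule, this runs the leading assignment and charges it to the budget; the
  inequality guards the truncated subtraction.\<close>

lemma tot_Seq_IStore [simp]:
  "tot (Seq (IStore a e f) d) s B Q \<longleftrightarrow> icost e + icost f + 1 \<le> B \<and>
     tot d (upd (fst s) a (ival e s) (ival f s), snd s) (B - (icost e + icost f + 1)) Q"
proof
  assume "tot (Seq (IStore a e f) d) s B Q"
  then show "icost e + icost f + 1 \<le> B \<and>
     tot d (upd (fst s) a (ival e s) (ival f s), snd s) (B - (icost e + icost f + 1)) Q"
    unfolding tot_def by (fastforce elim!: exec_SeqE exec_IStoreE)
next
  assume "icost e + icost f + 1 \<le> B \<and>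
     tot d (upd (fst s) a (ival e s) (ival f s), snd s) (B - (icost e + icost f + 1)) Q"
  then show "tot (Seq (IStore a e f) d) s B Q"
    by (intro tot_Seq[where ?B1.0 = "icost e + icost f + 1" and
        ?B2.0 = "B - (icost e + icost f + 1)" and
        P = "\<lambda>s'. s' = (upd (fst s) a (ival e s) (ival f s), snd s)"]) auto
qed

lemma tot_Seq_RStore [simp]:
  "tot (Seq (RStore a e f) d) s B Q \<longleftrightarrow> icost e + rcost f + 1 \<le> B \<and>
     tot d (fst s, upd (snd s) a (ival e s) (rval f s)) (B - (icost e + rcost f + 1)) Q"
proof
  assume "tot (Seq (RStore a e f) d) s B Q"
  then show "icost e + rcost f + 1 \<le> B \<and>
     tot d (fst s, upd (snd s) a (ival e s) (rval f s)) (B - (icost e + rcost f + 1)) Q"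
    unfolding tot_def by (fastforce elim!: exec_SeqE exec_RStoreE)
next
  assume "icost e + rcost f + 1 \<le> B \<and>
     tot d (fst s, upd (snd s) a (ival e s) (rval f s)) (B - (icost e + rcost f + 1)) Q"
  then show "tot (Seq (RStore a e f) d) s B Q"
    by (intro tot_Seq[where ?B1.0 = "icost e + rcost f + 1" and
        ?B2.0 = "B - (icost e + rcost f + 1)" and
        P = "\<lambda>s'. s' = (fst s, upd (snd s) a (ival e s) (rval f s))"]) auto
qed

lemma tot_Cond:
  assumes "bval b s \<Longrightarrow> tot c s B1 Q" "\<not> bval b s \<Longrightarrow> tot d s B1 Q" "bcost b + B1 \<le> B"
  shows "tot (Cond b c d) s B Q"
proof (cases "bval b s")
  case True
  then obtain n s' where "exec c s n (Some s')" "n \<le> B1" "Q s'"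
    using assms(1) unfolding tot_def by blast
  then show ?thesis
    unfolding tot_def using exec.CondTrue[OF True] assms(3)
    by (intro exI[of _ "bcost b + n"] exI[of _ s']) simp
next
  case False
  then obtain n s' where "exec d s n (Some s')" "n \<le> B1" "Q s'"
    using assms(2) unfolding tot_def by blast
  then show ?thesis
    unfolding tot_def using exec.CondFalse[OF False] assms(3)
    by (intro exI[of _ "bcost b + n"] exI[of _ s']) simp
qed

abbreviation ivar :: "nat \<Rightarrow> iexp" where "ivar a \<equiv> ILoad a (INat 0)"
abbreviation rvar :: "nat \<Rightarrow> rexp" where "rvar a \<equiv> RLoad a (INat 0)"

text \<open>The counter and the bound are the cells 0 of the integer arrays \<open>a\<close> and \<open>b\<close>.\<close>

definition For :: "nat \<Rightarrow> nat \<Rightarrow> com \<Rightarrow> com" where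
  "For a b c = Seq (IStore a (INat 0) (INat 0)) (Loop (ILess (ivar a) (ivar b))
     (Seq c (IStore a (INat 0) (IAdd (ivar a) (INat 1)))))"

text \<open>\<open>I i\<close> is the invariant at the loop head after \<open>i\<close> rounds. The
  body is judged before the increment, hence the updated counter in its postcondition. A round costs
  5 for the guard and 6 for the increment besides the body; 8 pays for the initialisation and the
  last guard.\<close>

lemma tot_For:
  assumes init: "I 0 (upd (fst s) a 0 0, snd s)"
    and head: "\<And>i s. I i s \<Longrightarrow> fst s a 0 = i \<and> fst s b 0 = n"
    and body: "\<And>i s. i < n \<Longrightarrow> I i s \<Longrightarrow>
      tot c s B (\<lambda>s'. I (Suc i) (upd (fst s') a 0 (Suc (fst s' a 0)), snd s'))"
    and B: "n * (B + 11) + 8 \<le> B'"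
    and Q: "\<And>s. I n s \<Longrightarrow> Q s"
  shows "tot (For a b c) s B' Q"
proof -
  let ?b = "ILess (ivar a) (ivar b)" and ?inc = "IStore a (INat 0) (IAdd (ivar a) (INat 1))"
  \<comment> \<open>Induction downwards from \<open>n\<close>: the remaining run when the counter is
    \<open>i\<close>.\<close>
  have loop: "\<exists>m s'. exec (Loop ?b (Seq c ?inc)) s m (Some s') \<and> m \<le> (n - i) * (B + 11) + 5 \<and> I n s'"
    if "i \<le> n" "I i s" for i s
    using that
  proof (induction i arbitrary: s rule: inc_induct)
    case base
    then have "\<not> bval ?b s" using head by auto
    from exec.LoopEnd[OF this] show ?case using base by fastforce
  next
    case (step i)
    have guard: "bval ?b s" using head[OF step.prems] step.hyps by auto
    obtain m s1 where 1: "exec c s m (Some s1)" "m \<le> B"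
      "I (Suc i) (upd (fst s1) a 0 (Suc (fst s1 a 0)), snd s1)"
      using body[OF step.hyps(2) step.prems] unfolding tot_def by blast
    have "exec (Seq c ?inc) s (m + 6) (Some (upd (fst s1) a 0 (Suc (fst s1 a 0)), snd s1))"
      using exec.Seq[OF 1(1) exec.IStore[of a "INat 0" "IAdd (ivar a) (INat 1)" s1]]
      by (simp add: eval_nat_numeral)
    moreover obtain l s2 where 2: "exec (Loop ?b (Seq c ?inc))
        (upd (fst s1) a 0 (Suc (fst s1 a 0)), snd s1) l (Some s2)"
      "l \<le> (n - Suc i) * (B + 11) + 5" "I n s2"
      using step.IH[OF 1(3)] by blast
    ultimately have "exec (Loop ?b (Seq c ?inc)) s (bcost ?b + (m + 6) + l) (Some s2)"
      using exec.LoopStep[OF guard] by blast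
    moreover have "bcost ?b + (m + 6) + l \<le> (n - i) * (B + 11) + 5"
    proof -
      have "(n - i) * (B + 11) = (n - Suc i) * (B + 11) + (B + 11)"
        using step.hyps(2) by (metis Suc_diff_Suc add.commute mult_Suc)
      then show ?thesis using 1(2) 2(2) by simp
    qed
    ultimately show ?case using 2(3) by blast
  qed
  from loop[OF _ init] obtain m s' where m:
      "exec (Loop ?b (Seq c ?inc)) (upd (fst s) a 0 0, snd s) m (Some s')"
      "m \<le> n * (B + 11) + 5" "I n s'"
    by auto
  then have "tot (Loop ?b (Seq c ?inc)) (upd (fst s) a 0 0, snd s) (B' - 3) Q"
    unfolding tot_def using B Q by (intro exI[of _ m] exI[of _ s']) auto
  then show ?thesis
    unfolding For_def using B by (simp add: numeral_3_eq_3)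
qed

section \<open>The algorithm\<close>

definition frame :: "nat set \<Rightarrow> nat set \<Rightarrow> state \<Rightarrow> state \<Rightarrow> bool" where
  "frame A B s s' \<longleftrightarrow>
     (\<forall>a. a \<notin> A \<longrightarrow> fst s' a = fst s a) \<and> (\<forall>a. a \<notin> B \<longrightarrow> snd s' a = snd s a)"

text \<open>
  Memory layout.  Integer arrays: 1 holds \<open>2\<^sup>k\<close>, 2 and 3 the quotients and remainders
  of the row indices by 2, 4 their Hamming weights; 5 to 9 are counters and scratch, 10 is first the failure flag and
  later the write position in the matrix.
  Real arrays: 3 and 4 are the two buffers of the Walsh transform, 5 and 6 accumulators,
  7 the constant Fourier coefficient of the weights, 8 the normalising factor.
\<close>

definition flag_prog :: com where
  "flag_prog = For 5 0 (Cond (BAnd (BNot (RLess (rvar 0) (RNat (ivar 5))))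
       (BNot (RLess (RNat (ivar 5)) (rvar 0))))
     (IStore 10 (INat 0) (INat 1)) Skip)"

text \<open>Reals have neither rounding nor an equality test, so \<open>p\<close> is compared with
  each counter value by two negated inequalities. A flag is set in place of \<open>Fail\<close>
  because \<open>tot_For\<close> covers normal termination only.\<close>

lemma tot_flag_prog:
  assumes "fst s 10 0 = 0"
  shows "tot flag_prog s (fst s 0 0 * 41 + 8) (\<lambda>s'. frame {5, 10} {} s s' \<and>
     (fst s' 10 0 = 0 \<longleftrightarrow> (\<forall>m<fst s 0 0. snd s 0 0 \<noteq> real m)))"
  unfolding flag_prog_def
proof (rule tot_For[where I = "\<lambda>i t. frame {5, 10} {} s t \<and> fst t 5 0 = i \<and>
      (fst t 10 0 = 0 \<longleftrightarrow> (\<forall>m<i. snd s 0 0 \<noteq> real m))" and n = "fst s 0 0" and B = 30], goal_cases)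
  case (3 i t)
  then show ?case
    by (intro tot_Cond[where ?B1.0 = 5])
       (auto simp: frame_def less_Suc_eq)
qed (use assms in \<open>auto simp: frame_def\<close>)

section \<open>Tables of bits, Hamming weights and their powers\<close>

definition size_prog :: com where
  "size_prog = Seq (IStore 1 (INat 0) (INat 1)) (For 5 0 (IStore 1 (INat 0) (IAdd (ivar 1) (ivar 1))))"

lemma tot_size_prog:
  "tot size_prog s (fst s 0 0 * 31 + 18) (\<lambda>s'. frame {1, 5} {} s s' \<and> fst s' 1 0 = 2 ^ fst s 0 0)"
proof -
  define t where "t = (upd (fst s) 1 0 1, snd s)"
  have "tot (For 5 0 (IStore 1 (INat 0) (IAdd (ivar 1) (ivar 1)))) t (fst s 0 0 * 31 + 8)
      (\<lambda>s'. frame {1, 5} {} s s' \<and> fst s' 1 0 = 2 ^ fst s 0 0)"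
    by (rule tot_For[where I = "\<lambda>i t. frame {1, 5} {} s t \<and> fst t 5 0 = i \<and> fst t 1 0 = 2 ^ i"
          and n = "fst s 0 0" and B = 20])
       (auto simp: frame_def t_def)
  then show ?thesis
    unfolding size_prog_def by (auto simp: t_def elim!: tot_mono)
qed

definition bits_prog :: com where
  "bits_prog = For 5 1 (Seq
     (IStore 2 (IAdd (ivar 5) (INat 1)) (IAdd (ILoad 2 (ivar 5)) (ILoad 3 (ivar 5))))
     (IStore 3 (IAdd (ivar 5) (INat 1)) (ISub (INat 1) (ILoad 3 (ivar 5)))))"

definition bit_tables :: "state \<Rightarrow> bool" where
  "bit_tables s \<longleftrightarrow> (\<forall>u<fst s 1 0. fst s 2 u = u div 2 \<and> fst s 3 u = u mod 2)"

text \<open>There is no division of naturals. From quotient \<open>q\<close> and remainder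
  \<open>r\<close> of \<open>u\<close>, those of \<open>u + 1\<close> are \<open>q + r\<close> and
  \<open>1 - r\<close>; the zero-initialised memory supplies the entry for
  \<open>u = 0\<close>.\<close>

lemma tot_bits_prog:
  assumes "fst s 2 0 = 0" "fst s 3 0 = 0"
  shows "tot bits_prog s (fst s 1 0 * 51 + 8) (\<lambda>s'. frame {2, 3, 5} {} s s' \<and> bit_tables s')"
  unfolding bits_prog_def
proof (rule tot_For[where I = "\<lambda>i t. frame {2, 3, 5} {} s t \<and> fst t 5 0 = i \<and>
      (\<forall>u\<le>i. fst t 2 u = u div 2 \<and> fst t 3 u = u mod 2)" and n = "fst s 1 0" and B = 40], goal_cases)
  case (3 i t)
  have "i div 2 + i mod 2 = Suc i div 2" "1 - i mod 2 = Suc i mod 2" by presburger+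
  with 3 show ?case by (auto simp: frame_def le_Suc_eq)
qed (use assms in \<open>auto simp: frame_def bit_tables_def\<close>)

text \<open>Bit 0 is \<open>u mod 2\<close>, and the other bits are those of \<open>u div 2\<close>
  shifted by one. This is the recurrence for the table of Hamming weights.\<close>

lemma card_set_decode:
  "card (set_decode u) = card (set_decode (u div 2)) + u mod 2"
proof -
  have "set_decode u = (if odd u then {0} else {}) \<union> Suc ` set_decode (u div 2)"
  proof (rule Set.set_eqI)
    fix i show "i \<in> set_decode u \<longleftrightarrow> i \<in> (if odd u then {0} else {}) \<union> Suc ` set_decode (u div 2)"
      by (cases i) (auto simp del: set_decode_Suc simp: set_decode_Suc[symmetric])
  qed
  then show ?thesis
    by (simp add: card_image card_Un_disjoint odd_iff_mod_2_eq_one even_iff_mod_2_eq_zero)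
qed

definition powers_prog :: com where
  "powers_prog = For 5 1 (Seq
     (IStore 4 (ivar 5) (IAdd (ILoad 4 (ILoad 2 (ivar 5))) (ILoad 3 (ivar 5))))
     (RStore 3 (ivar 5) (RPow (RNat (ILoad 4 (ivar 5))) (rvar 0))))"

lemma tot_powers_prog:
  assumes "bit_tables s" "fst s 4 0 = 0"
  shows "tot powers_prog s (fst s 1 0 * 51 + 8) (\<lambda>s'. frame {4, 5} {3} s s' \<and>
     (\<forall>u<fst s 1 0. fst s' 4 u = card (set_decode u) \<and>
        snd s' 3 u = real (card (set_decode u)) powr snd s 0 0))"
  unfolding powers_prog_def
proof (rule tot_For[where I = "\<lambda>i t. frame {4, 5} {3} s t \<and> fst t 5 0 = i \<and> fst t 4 0 = 0 \<and>
      (\<forall>u<i. fst t 4 u = card (set_decode u) \<and>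
        snd t 3 u = real (card (set_decode u)) powr snd s 0 0)" and n = "fst s 1 0" and B = 40], goal_cases)
  case (3 i t)
  then have *: "fst t 2 i = i div 2" "fst t 3 i = i mod 2" "fst t 4 0 = 0"
    "fst t 0 = fst s 0" "snd t 0 = snd s 0"
    using assms(1) by (auto simp: bit_tables_def frame_def)
  \<comment> \<open>For \<open>i > 0\<close> the entry at \<open>i div 2\<close> is already filled;
    for \<open>i = 0\<close> the cell being read is the one about to be written, still 0.\<close>
  have "fst t 4 (i div 2) + i mod 2 = card (set_decode i)"
  proof (cases "i = 0")
    case False
    then show ?thesis using 3 by (subst card_set_decode) auto
  qed (use 3 in simp)
  with * 3 show ?case by (auto simp: frame_def less_Suc_eq)
qed (use assms in \<open>auto simp: frame_def\<close>)

section \<open>Characters and the Walsh transform as programs\<close>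

definition sign_prog :: com where
  "sign_prog = For 7 0 (Seq (RStore 6 (INat 0) (RMul (rvar 6) (RSub (RNat (INat 1))
       (RMul (RNat (INat 2)) (RMul (RNat (ILoad 3 (ivar 8))) (RNat (ILoad 3 (ivar 9))))))))
     (Seq (IStore 8 (INat 0) (ILoad 2 (ivar 8))) (IStore 9 (INat 0) (ILoad 2 (ivar 9)))))"

text \<open>A factor is -1 exactly where both bits are set, and \<open>S\<close> has no bits from
  position \<open>k\<close> on.\<close>

lemma prod_bits_sign:
  assumes "S < 2 ^ k"
  shows "(\<Prod>j<k. 1 - 2 * (real (S div 2 ^ j mod 2) * real (u div 2 ^ j mod 2)))
    = (- 1) ^ card (set_decode S \<inter> set_decode u)"
proof -
  have S: "set_decode S \<subseteq> {..<k}"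
    using bij_betw_imp_surj_on[OF bij_betw_set_decode[of k]] assms by auto
  define D where "D = set_decode S \<inter> set_decode u"
  have "(\<Prod>j<k. 1 - 2 * (real (S div 2 ^ j mod 2) * real (u div 2 ^ j mod 2)))
    = (\<Prod>j<k. if j \<in> D then - 1 else 1)"
    by (intro prod.cong refl)
       (auto simp: D_def set_decode_def odd_iff_mod_2_eq_one even_iff_mod_2_eq_zero)
  also have "\<dots> = (- 1) ^ card ({..<k} \<inter> D)"
    by (simp add: prod.If_cases)
  also have "{..<k} \<inter> D = D"
    using S by (auto simp: D_def)
  finally show ?thesis by (simp add: D_def)
qed

lemma tot_sign_prog:
  assumes "bit_tables s" "fst s 1 0 = 2 ^ fst s 0 0"
    and "snd s 6 0 = 1" "fst s 8 0 < fst s 1 0" "fst s 9 0 < fst s 1 0"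
  shows "tot sign_prog s (fst s 0 0 * 51 + 8) (\<lambda>s'. frame {7, 8, 9} {6} s s' \<and>
     snd s' 6 0 = (- 1) ^ card (set_decode (fst s 8 0) \<inter> set_decode (fst s 9 0)))"
  unfolding sign_prog_def
proof (rule tot_For[where I = "\<lambda>i t. frame {7, 8, 9} {6} s t \<and> fst t 7 0 = i \<and>
      fst t 8 0 = fst s 8 0 div 2 ^ i \<and> fst t 9 0 = fst s 9 0 div 2 ^ i \<and>
      snd t 6 0 = (\<Prod>j<i. 1 - 2 * (real (fst s 8 0 div 2 ^ j mod 2) * real (fst s 9 0 div 2 ^ j mod 2)))"
      and n = "fst s 0 0" and B = 40], goal_cases)
  case (3 i t)
  \<comment> \<open>Shifted indices only decrease, so they stay within the range covered by the
    tables.\<close>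
  have "fst s 8 0 div 2 ^ i < fst s 1 0" "fst s 9 0 div 2 ^ i < fst s 1 0"
    using assms by (meson div_le_dividend le_less_trans)+
  then have "fst t 2 (fst s 8 0 div 2 ^ i) = fst s 8 0 div 2 ^ Suc i"
    "fst t 2 (fst s 9 0 div 2 ^ i) = fst s 9 0 div 2 ^ Suc i"
    "fst t 3 (fst s 8 0 div 2 ^ i) = fst s 8 0 div 2 ^ i mod 2"
    "fst t 3 (fst s 9 0 div 2 ^ i) = fst s 9 0 div 2 ^ i mod 2"
    using 3 assms(1) by (auto simp: bit_tables_def frame_def div_mult2_eq power_Suc2 simp del: power_Suc)
  with 3 show ?case by (auto simp: frame_def)
qed (use assms in \<open>auto simp: frame_def prod_bits_sign\<close>)

text \<open>Direct summation from array \<open>a\<close> into array \<open>b\<close>; about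
  \<open>k * 4 ^ k\<close> steps are polynomial in \<open>2 ^ k\<close>.\<close>

definition walsh_prog :: "nat \<Rightarrow> nat \<Rightarrow> com" where
  "walsh_prog a b = For 5 1 (Seq (RStore 5 (INat 0) (RNat (INat 0)))
     (Seq (For 6 1 (Seq (IStore 8 (INat 0) (ivar 5)) (Seq (IStore 9 (INat 0) (ivar 6))
        (Seq (RStore 6 (INat 0) (RNat (INat 1))) (Seq sign_prog
        (RStore 5 (INat 0) (RAdd (rvar 5) (RMul (rvar 6) (RLoad a (ivar 6))))))))))
      (RStore b (ivar 5) (rvar 5))))"

lemma tot_walsh_prog:
  assumes "bit_tables s" "fst s 1 0 = 2 ^ fst s 0 0" and ab: "a \<notin> {5, 6}" "b \<notin> {5, 6}" "a \<noteq> b"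
  shows "tot (walsh_prog a b) s (fst s 1 0 * (fst s 1 0 * (fst s 0 0 * 51 + 61) + 41) + 8)
    (\<lambda>s'. frame {5, 6, 7, 8, 9} {b, 5, 6} s s' \<and> (\<forall>S<fst s 1 0. snd s' b S =
       (\<Sum>u<fst s 1 0. (- 1) ^ card (set_decode S \<inter> set_decode u) * snd s a u)))"
proof -
  define N where "N = fst s 1 0"
  define k where "k = fst s 0 0"
  define F where "F t \<longleftrightarrow> frame {5, 6, 7, 8, 9} {b, 5, 6} s t" for t
  define g where "g S u = (- 1) ^ card (set_decode S \<inter> set_decode u) * snd s a u" for S u
  have F: "fst t 1 = fst s 1 \<and> fst t 0 = fst s 0 \<and> snd t a = snd s a \<and> bit_tables t" if "F t" for t
    using that assms unfolding F_def by (auto simp: frame_def bit_tables_def)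
  define c where "c = Seq (IStore 8 (INat 0) (ivar 5)) (Seq (IStore 9 (INat 0) (ivar 6))
        (Seq (RStore 6 (INat 0) (RNat (INat 1))) (Seq sign_prog
        (RStore 5 (INat 0) (RAdd (rvar 5) (RMul (rvar 6) (RLoad a (ivar 6))))))))"
  have c: "tot c t (k * 51 + 50) (\<lambda>t'. F t' \<and> fst t' 5 0 = S \<and> fst t' 6 0 = u \<and>
      snd t' 5 0 = snd t 5 0 + g S u \<and> (\<forall>S'. snd t' b S' = snd t b S'))"
    if t: "F t" "fst t 5 0 = S" "fst t 6 0 = u" "S < N" "u < N" for t S u
  proof -
    define t' where "t' = (upd (upd (fst t) 8 0 S) 9 0 u, upd (snd t) 6 0 1)"
    have t': "F t'" "fst t' 8 0 = S" "fst t' 9 0 = u" "snd t' 6 0 = 1" "fst t' 5 0 = S" "fst t' 6 0 = u"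
      "snd t' 5 0 = snd t 5 0" "snd t' b = snd t b"
      using t ab by (auto simp: t'_def F_def frame_def)
    have "tot (Seq sign_prog (RStore 5 (INat 0) (RAdd (rvar 5) (RMul (rvar 6) (RLoad a (ivar 6)))))) t'
      (k * 51 + 38) (\<lambda>t'. F t' \<and> fst t' 5 0 = S \<and> fst t' 6 0 = u \<and>
      snd t' 5 0 = snd t 5 0 + g S u \<and> (\<forall>S'. snd t' b S' = snd t b S'))"
    proof (rule tot_Seq[where ?B2.0 = 30])
      show "tot sign_prog t' (k * 51 + 8) (\<lambda>s'. frame {7, 8, 9} {6} t' s' \<and>
        snd s' 6 0 = (- 1) ^ card (set_decode S \<inter> set_decode u))"
        using tot_sign_prog[of t'] t' F[OF t'(1)] assms t unfolding k_def N_def by simp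
    next
      fix r assume "frame {7, 8, 9} {6} t' r \<and> snd r 6 0 = (- 1) ^ card (set_decode S \<inter> set_decode u)"
      then show "tot (RStore 5 (INat 0) (RAdd (rvar 5) (RMul (rvar 6) (RLoad a (ivar 6))))) r 30
        (\<lambda>t'. F t' \<and> fst t' 5 0 = S \<and> fst t' 6 0 = u \<and>
          snd t' 5 0 = snd t 5 0 + g S u \<and> (\<forall>S'. snd t' b S' = snd t b S'))"
        using t' F[OF t'(1)] ab by (auto simp: F_def frame_def g_def)
    qed simp
    then show ?thesis
      unfolding c_def using t by (auto simp: t'_def elim!: tot_mono)
  qed
  have inner: "tot (For 6 1 c) t (N * (k * 51 + 61) + 8) (\<lambda>t'. F t' \<and> fst t' 5 0 = S \<and>
      snd t' 5 0 = (\<Sum>u<N. g S u) \<and> (\<forall>S'. snd t' b S' = snd t b S'))"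
    if t: "F t" "fst t 5 0 = S" "snd t 5 0 = 0" "S < N" for t S
  proof (rule tot_For[where I = "\<lambda>i t'. F t' \<and> fst t' 6 0 = i \<and> fst t' 5 0 = S \<and>
        snd t' 5 0 = (\<Sum>u<i. g S u) \<and> (\<forall>S'. snd t' b S' = snd t b S')" and n = N and B = "k * 51 + 50"],
      goal_cases)
    case (3 i t')
    then show ?case
      using c[of t' S i] t
      by (elim tot_mono[OF c[of t' S i]] conjE) (auto simp: F_def frame_def)
  qed (use t ab in \<open>auto simp: F_def frame_def N_def\<close>)
  have "tot (walsh_prog a b) s (N * (N * (k * 51 + 61) + 41) + 8)
     (\<lambda>s'. F s' \<and> (\<forall>S<N. snd s' b S = (\<Sum>u<N. g S u)))"
    unfolding walsh_prog_def c_def[symmetric]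
  proof (rule tot_For[where I = "\<lambda>i t'. F t' \<and> fst t' 5 0 = i \<and>
        (\<forall>S<i. snd t' b S = (\<Sum>u<N. g S u))" and n = N and B = "N * (k * 51 + 61) + 30"],
      goal_cases)
    case (3 i t)
    define t' where "t' = (fst t, upd (snd t) 5 0 0)"
    have t': "F t'" "fst t' 5 0 = i" "snd t' 5 0 = 0" "snd t' b = snd t b"
      using 3 ab by (auto simp: t'_def F_def frame_def)
    have "tot (Seq (For 6 1 c) (RStore b (ivar 5) (rvar 5))) t' (N * (k * 51 + 61) + 20)
       (\<lambda>s'. F (upd (fst s') 5 0 (Suc (fst s' 5 0)), snd s') \<and>
         fst (upd (fst s') 5 0 (Suc (fst s' 5 0)), snd s') 5 0 = Suc i \<and>
         (\<forall>S<Suc i. snd (upd (fst s') 5 0 (Suc (fst s' 5 0)), snd s') b S = (\<Sum>u<N. g S u)))"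
    proof (rule tot_Seq[OF inner[OF t'(1-3) 3(1)], where ?B2.0 = 12], goal_cases)
      case (1 r)
      then show ?case
        using 3 t' ab by (auto simp: F_def frame_def less_Suc_eq)
    qed simp
    then show ?case by (auto simp: t'_def elim!: tot_mono)
  qed (use ab in \<open>auto simp: F_def frame_def N_def\<close>)
  then show ?thesis
    by (simp add: N_def k_def F_def g_def)
qed

section \<open>Inverting the spectrum and writing the output\<close>

definition invert_prog :: com where
  "invert_prog = Seq (RStore 7 (INat 0) (RNat (INat 1)))
     (Seq (For 5 1 (Seq (RStore 4 (ivar 5) (RDiv (RNat (INat 1)) (RLoad 4 (ivar 5))))
        (RStore 7 (INat 0) (RAdd (rvar 7) (RPow (RLoad 4 (ivar 5)) (RNat (INat 1)))))))
     (Seq (RStore 8 (INat 0) (RSub (RDiv (rvar 7) (rvar 4)) (RNat (INat 1))))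
        (RStore 4 (INat 0) (rvar 7))))"

text \<open>The power with exponent 1 computes an absolute value. Cell 0 of array 4 already holds
  the inverse of the constant coefficient, so multiplying by that coefficient is done by dividing by
  the cell; with \<open>x / 0 = 0\<close> this is right even if the coefficient is 0.\<close>

lemma tot_invert_prog:
  fixes s :: state
  defines "C \<equiv> 1 + (\<Sum>u<fst s 1 0. \<bar>1 / snd s 4 u\<bar>)"
  assumes "fst s 1 0 > 0"
  shows "tot invert_prog s (fst s 1 0 * 51 + 50) (\<lambda>s'. frame {5} {4, 7, 8} s s' \<and>
     snd s' 8 0 = C * snd s 4 0 - 1 \<and>
     (\<forall>u<fst s 1 0. snd s' 4 u = (if u = 0 then C else 1 / snd s 4 u)))"
proof -
  define N where "N = fst s 1 0"
  define t where "t = (fst s, upd (snd s) 7 0 1)"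
  have "tot (Seq (For 5 1 (Seq (RStore 4 (ivar 5) (RDiv (RNat (INat 1)) (RLoad 4 (ivar 5))))
        (RStore 7 (INat 0) (RAdd (rvar 7) (RPow (RLoad 4 (ivar 5)) (RNat (INat 1)))))))
     (Seq (RStore 8 (INat 0) (RSub (RDiv (rvar 7) (rvar 4)) (RNat (INat 1))))
        (RStore 4 (INat 0) (rvar 7)))) t (N * 51 + 40) (\<lambda>s'. frame {5} {4, 7, 8} s s' \<and>
     snd s' 8 0 = C * snd s 4 0 - 1 \<and>
     (\<forall>u<N. snd s' 4 u = (if u = 0 then C else 1 / snd s 4 u)))"
  proof (rule tot_Seq[where ?B1.0 = "N * 51 + 8" and ?B2.0 = 30])
    show "tot (For 5 1 (Seq (RStore 4 (ivar 5) (RDiv (RNat (INat 1)) (RLoad 4 (ivar 5))))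
        (RStore 7 (INat 0) (RAdd (rvar 7) (RPow (RLoad 4 (ivar 5)) (RNat (INat 1))))))) t (N * 51 + 8)
        (\<lambda>s'. frame {5} {4, 7} s s' \<and> snd s' 7 0 = C \<and> (\<forall>u<N. snd s' 4 u = 1 / snd s 4 u))"
      by (rule tot_For[where I = "\<lambda>i t. frame {5} {4, 7} s t \<and> fst t 5 0 = i \<and>
            snd t 7 0 = 1 + (\<Sum>u<i. \<bar>1 / snd s 4 u\<bar>) \<and>
            (\<forall>u. snd t 4 u = (if u < i then 1 / snd s 4 u else snd s 4 u))" and n = N and B = 40])
         (auto simp: frame_def t_def N_def C_def less_Suc_eq)
  qed (use assms(2) in \<open>auto simp: frame_def N_def\<close>)
  then show ?thesis
    unfolding invert_prog_def by (auto simp: t_def N_def elim!: tot_mono)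
qed

definition output_prog :: com where
  "output_prog = Seq (IStore 10 (INat 0) (INat 0)) (For 5 1
     (Seq (RStore 5 (INat 0) (RPow (RDiv (RLoad 3 (ivar 5)) (rvar 8)) (RDiv (RNat (INat 1)) (rvar 0))))
     (Seq (RStore 2 (ivar 5) (RSub (RNat (INat 0)) (RMul (rvar 5) (RNat (ILoad 4 (ivar 5))))))
     (Seq (IStore 8 (INat 0) (ivar 5))
     (For 6 0 (Seq (RStore 1 (ivar 10) (RMul (rvar 5)
          (RSub (RNat (INat 1)) (RMul (RNat (INat 2)) (RNat (ILoad 3 (ivar 8)))))))
        (Seq (IStore 8 (INat 0) (ILoad 2 (ivar 8)))
        (IStore 10 (INat 0) (IAdd (ivar 10) (INat 1))))))))))"

text \<open>Naturals cannot be multiplied by the program, so the row-major position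
  \<open>u * k + j\<close> is kept as a running counter, while the row index is shifted right to
  read its bits.\<close>

lemma tot_output_prog:
  fixes s :: state
  defines "\<alpha> \<equiv> \<lambda>u. \<bar>snd s 3 u / snd s 8 0\<bar> powr (1 / snd s 0 0)"
  assumes "bit_tables s"
  shows "tot output_prog s (fst s 1 0 * (fst s 0 0 * 51 + 71) + 20) (\<lambda>s'. \<forall>u<fst s 1 0.
     snd s' 2 u = - (\<alpha> u * real (fst s 4 u)) \<and>
     (\<forall>j<fst s 0 0. snd s' 1 (u * fst s 0 0 + j) = \<alpha> u * (1 - 2 * real (u div 2 ^ j mod 2))))"
proof -
  define N where "N = fst s 1 0"
  define k where "k = fst s 0 0"
  define F where "F t \<longleftrightarrow> frame {5, 6, 8, 10} {1, 2, 5} s t" for t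
  have F: "fst t 1 = fst s 1 \<and> fst t 0 = fst s 0 \<and> fst t 2 = fst s 2 \<and> fst t 3 = fst s 3
      \<and> fst t 4 = fst s 4 \<and> snd t 3 = snd s 3 \<and> snd t 8 = snd s 8 \<and> snd t 0 = snd s 0" if "F t" for t
    using that unfolding F_def by (auto simp: frame_def)
  define v where "v u j = \<alpha> u * (1 - 2 * real (u div 2 ^ j mod 2))" for u j
  define c where "c = Seq (RStore 1 (ivar 10) (RMul (rvar 5)
          (RSub (RNat (INat 1)) (RMul (RNat (INat 2)) (RNat (ILoad 3 (ivar 8)))))))
        (Seq (IStore 8 (INat 0) (ILoad 2 (ivar 8)))
        (IStore 10 (INat 0) (IAdd (ivar 10) (INat 1))))"
  have inner: "tot (For 6 0 c) t (k * 51 + 8) (\<lambda>t'. F t' \<and> fst t' 5 0 = u \<and> fst t' 10 0 = u * k + k \<and>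
      snd t' 2 = snd t 2 \<and> (\<forall>q<u * k. snd t' 1 q = snd t 1 q) \<and> (\<forall>j<k. snd t' 1 (u * k + j) = v u j))"
    if t: "F t" "fst t 5 0 = u" "fst t 8 0 = u" "fst t 10 0 = u * k" "snd t 5 0 = \<alpha> u" "u < N" for t u
    unfolding c_def
  proof (rule tot_For[where I = "\<lambda>i t'. F t' \<and> fst t' 6 0 = i \<and> fst t' 5 0 = u \<and>
        fst t' 8 0 = u div 2 ^ i \<and> fst t' 10 0 = u * k + i \<and> snd t' 5 0 = \<alpha> u \<and>
        snd t' 2 = snd t 2 \<and> (\<forall>q<u * k. snd t' 1 q = snd t 1 q) \<and> (\<forall>j<i. snd t' 1 (u * k + j) = v u j)"
        and n = k and B = 40], goal_cases)
    case (3 i t')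
    have "u div 2 ^ i < fst s 1 0"
      using t by (metis N_def div_le_dividend le_less_trans)
    then have "fst t' 2 (u div 2 ^ i) = u div 2 ^ Suc i" "fst t' 3 (u div 2 ^ i) = u div 2 ^ i mod 2"
      using 3 F[of t'] assms(2)
      by (auto simp: bit_tables_def div_mult2_eq power_Suc2 simp del: power_Suc)
    with 3 show ?case by (auto simp: F_def frame_def v_def less_Suc_eq)
  qed (use t in \<open>auto simp: F_def frame_def k_def\<close>)
  define t where "t = (upd (fst s) 10 0 0, snd s)"
  have "tot (For 5 1
     (Seq (RStore 5 (INat 0) (RPow (RDiv (RLoad 3 (ivar 5)) (rvar 8)) (RDiv (RNat (INat 1)) (rvar 0))))
     (Seq (RStore 2 (ivar 5) (RSub (RNat (INat 0)) (RMul (rvar 5) (RNat (ILoad 4 (ivar 5))))))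
     (Seq (IStore 8 (INat 0) (ivar 5)) (For 6 0 c))))) t (N * (k * 51 + 71) + 8)
     (\<lambda>s'. \<forall>u<N. snd s' 2 u = - (\<alpha> u * real (fst s 4 u)) \<and> (\<forall>j<k. snd s' 1 (u * k + j) = v u j))"
  proof (rule tot_For[where I = "\<lambda>i t'. F t' \<and> fst t' 5 0 = i \<and> fst t' 10 0 = i * k \<and>
        (\<forall>u<i. snd t' 2 u = - (\<alpha> u * real (fst s 4 u)) \<and> (\<forall>j<k. snd t' 1 (u * k + j) = v u j))"
        and n = N and B = "k * 51 + 60"], goal_cases)
    case (3 i t)
    define t' where "t' = (upd (fst t) 8 0 i,
      upd (upd (snd t) 5 0 (\<alpha> i)) 2 i (- (\<alpha> i * real (fst s 4 i))))"
    have t': "F t'" "fst t' 5 0 = i" "fst t' 8 0 = i" "fst t' 10 0 = i * k" "snd t' 5 0 = \<alpha> i"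
      "snd t' 1 = snd t 1" "\<forall>u<i. snd t' 2 u = - (\<alpha> u * real (fst s 4 u))"
      "snd t' 2 i = - (\<alpha> i * real (fst s 4 i))"
      using 3 by (auto simp: t'_def F_def frame_def)
    \<comment> \<open>Entries of earlier rows lie before position \<open>i * k\<close>, so writing
      row \<open>i\<close> leaves them intact.\<close>
    have lt: "u * k + j < i * k" if "u < i" "j < k" for u j
    proof -
      have "u * k + j < Suc u * k" using that by simp
      also have "\<dots> \<le> i * k" using that by (intro mult_le_mono1) simp
      finally show ?thesis .
    qed
    have "tot (For 6 0 c) t' (k * 51 + 8) (\<lambda>s'. F (upd (fst s') 5 0 (Suc (fst s' 5 0)), snd s') \<and>
        fst (upd (fst s') 5 0 (Suc (fst s' 5 0)), snd s') 5 0 = Suc i \<and>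
        fst (upd (fst s') 5 0 (Suc (fst s' 5 0)), snd s') 10 0 = Suc i * k \<and>
        (\<forall>u<Suc i. snd (upd (fst s') 5 0 (Suc (fst s' 5 0)), snd s') 2 u = - (\<alpha> u * real (fst s 4 u)) \<and>
          (\<forall>j<k. snd (upd (fst s') 5 0 (Suc (fst s' 5 0)), snd s') 1 (u * k + j) = v u j)))"
    proof (rule tot_mono[OF inner[OF t'(1-5) 3(1)]], goal_cases)
      case (2 r)
      then show ?case
        using 3 t' lt by (auto simp: F_def frame_def less_Suc_eq)
    qed simp
    then show ?case
      using 3 F[of t] by (auto simp: t'_def \<alpha>_def elim!: tot_mono)
  qed (auto simp: F_def frame_def N_def t_def)
  then show ?thesis
    unfolding output_prog_def c_def[symmetric] by (auto simp: t_def N_def k_def v_def elim!: tot_mono)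
qed

lemma bit_tables_frame:
  assumes "bit_tables s" "frame A B s s'" "1 \<notin> A" "2 \<notin> A" "3 \<notin> A"
  shows "bit_tables s'"
  using assms by (simp add: bit_tables_def frame_def)

section \<open>Closed formulas for the computed numbers, and why they give an isolating
  parallelepiped\<close>

definition walsh :: "nat \<Rightarrow> (nat \<Rightarrow> real) \<Rightarrow> nat \<Rightarrow> real" where
  "walsh k f S = (\<Sum>u<2 ^ k. (- 1) ^ card (set_decode S \<inter> set_decode u) * f u)"

definition spectrum :: "nat \<Rightarrow> real \<Rightarrow> nat \<Rightarrow> real" where
  "spectrum k p = walsh k (\<lambda>u. real (card (set_decode u)) powr p)"

text \<open>Large enough to make all weights and the normalising factor positive.\<close>

definition offset :: "nat \<Rightarrow> real \<Rightarrow> real" where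
  "offset k p = 1 + (\<Sum>u<2 ^ k. \<bar>1 / spectrum k p u\<bar>)"

text \<open>Up to the factor \<open>2 ^ k\<close>, the inverse transform of the reciprocal spectrum
  with its constant coefficient replaced.\<close>

definition weight :: "nat \<Rightarrow> real \<Rightarrow> nat \<Rightarrow> real" where
  "weight k p = walsh k (\<lambda>u. if u = 0 then offset k p else 1 / spectrum k p u)"

text \<open>The denominator is the value of the weighted distance sum at every nonzero vertex;
  dividing by it normalises the norm there to 1.\<close>

definition row_scale :: "nat \<Rightarrow> real \<Rightarrow> nat \<Rightarrow> real" where
  "row_scale k p u = \<bar>weight k p u / (offset k p * spectrum k p 0 - 1)\<bar> powr (1 / p)"

definition main_prog :: com where
  "main_prog = Seq size_prog (Seq bits_prog (Seq powers_prog (Seq (walsh_prog 3 4)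
     (Seq invert_prog (Seq (walsh_prog 4 3) output_prog)))))"

text \<open>As all operations are total, these formulas hold for every real \<open>p\<close>; the
  condition on \<open>p\<close> enters only when the weights are shown to be correct.\<close>

lemma tot_main_prog:
  fixes s :: state
  defines "k \<equiv> fst s 0 0" and "p \<equiv> snd s 0 0"
  assumes "fst s 2 0 = 0" "fst s 3 0 = 0" "fst s 4 0 = 0"
  shows "tot main_prog s (900 * (2 ^ k) ^ 3) (\<lambda>s'. \<forall>u<2 ^ k.
     snd s' 2 u = - (row_scale k p u * real (card (set_decode u))) \<and>
     (\<forall>j<k. snd s' 1 (u * k + j) = row_scale k p u * (1 - 2 * real (u div 2 ^ j mod 2))))"
proof -
  define N :: nat where "N = 2 ^ k"
  define P where "P t \<longleftrightarrow> bit_tables t \<and> fst t 0 0 = k \<and> fst t 1 0 = N \<and> snd t 0 0 = p" for t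
  define Y where "Y u = (if u = 0 then offset k p else 1 / spectrum k p u)" for u
  define c where "c t \<longleftrightarrow> (\<forall>u<N. fst t 4 u = card (set_decode u))" for t :: state
  define V where "V a f t \<longleftrightarrow> (\<forall>u<N. snd t a u = f u)" for a and f :: "nat \<Rightarrow> real" and t :: state
  have P_frame: "P t'" if "P t" "frame A B t t'" "0 \<notin> A" "1 \<notin> A" "2 \<notin> A" "3 \<notin> A" "0 \<notin> B" for A B t t'
    using that bit_tables_frame[of t A B t'] by (auto simp: P_def frame_def)
  have 1: "tot size_prog s (k * 31 + 18)
      (\<lambda>t. frame {1, 5} {} s t \<and> fst t 1 0 = N)"
    using tot_size_prog[of s] by (simp add: k_def N_def)
  have 2: "tot bits_prog t (N * 51 + 8) (\<lambda>t. P t \<and> fst t 4 0 = 0)"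
    if "frame {1, 5} {} s t \<and> fst t 1 0 = N" for t
    using that assms by (intro tot_mono[OF tot_bits_prog[of t]]) (auto simp: P_def frame_def k_def p_def)
  have 3: "tot powers_prog t (N * 51 + 8) (\<lambda>t. P t \<and> c t \<and> V 3 (\<lambda>u. real (card (set_decode u)) powr p) t)"
    if "P t \<and> fst t 4 0 = 0" for t
    using that
    by (intro tot_mono[OF tot_powers_prog[of t]]) (auto simp: P_def V_def c_def frame_def bit_tables_def)
  have 4: "tot (walsh_prog 3 4) t (N * (N * (k * 51 + 61) + 41) + 8) (\<lambda>t. P t \<and> c t \<and> V 4 (spectrum k p) t)"
    if t: "P t \<and> c t \<and> V 3 (\<lambda>u. real (card (set_decode u)) powr p) t" for t
    using t
    by (intro tot_mono[OF tot_walsh_prog[of t 3 4]])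
       (auto simp: P_def V_def c_def frame_def bit_tables_def N_def spectrum_def walsh_def)
  have 5: "tot invert_prog t (N * 51 + 50) (\<lambda>t. P t \<and> c t \<and> V 4 Y t \<and> snd t 8 0 = offset k p * spectrum k p 0 - 1)"
    if t: "P t \<and> c t \<and> V 4 (spectrum k p) t" for t
    using t
    by (intro tot_mono[OF tot_invert_prog[of t]])
       (auto simp: P_def V_def c_def frame_def bit_tables_def N_def Y_def offset_def)
  have 6: "tot (walsh_prog 4 3) t (N * (N * (k * 51 + 61) + 41) + 8)
      (\<lambda>t. P t \<and> c t \<and> V 3 (weight k p) t \<and> snd t 8 0 = offset k p * spectrum k p 0 - 1)"
    if t: "P t \<and> c t \<and> V 4 Y t \<and> snd t 8 0 = offset k p * spectrum k p 0 - 1" for t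
    using t
    by (intro tot_mono[OF tot_walsh_prog[of t 4 3]])
       (auto simp: P_def V_def c_def frame_def bit_tables_def N_def Y_def weight_def walsh_def)
  have 7: "tot output_prog t (N * (k * 51 + 71) + 20) (\<lambda>s'. \<forall>u<N.
     snd s' 2 u = - (row_scale k p u * real (card (set_decode u))) \<and>
     (\<forall>j<k. snd s' 1 (u * k + j) = row_scale k p u * (1 - 2 * real (u div 2 ^ j mod 2))))"
    if t: "P t \<and> c t \<and> V 3 (weight k p) t \<and> snd t 8 0 = offset k p * spectrum k p 0 - 1" for t
    using t
    by (intro tot_mono[OF tot_output_prog[of t]])
       (auto simp: P_def V_def c_def row_scale_def)
  have "tot main_prog s ((k * 31 + 18) + ((N * 51 + 8) + ((N * 51 + 8) +
      ((N * (N * (k * 51 + 61) + 41) + 8) + ((N * 51 + 50) + ((N * (N * (k * 51 + 61) + 41) + 8) +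
      (N * (k * 51 + 71) + 20)))))))
    (\<lambda>s'. \<forall>u<N. snd s' 2 u = - (row_scale k p u * real (card (set_decode u))) \<and>
     (\<forall>j<k. snd s' 1 (u * k + j) = row_scale k p u * (1 - 2 * real (u div 2 ^ j mod 2))))"
    unfolding main_prog_def
    by (rule tot_Seq[OF 1 tot_Seq[OF 2 tot_Seq[OF 3 tot_Seq[OF 4 tot_Seq[OF 5 tot_Seq[OF 6 7]]]]]];
        (assumption | rule order_refl))
  then show ?thesis
    unfolding N_def[symmetric]
  proof (rule tot_mono)
    \<comment> \<open>By \<open>k \<le> N\<close> and \<open>1 \<le> N\<close>, every summand is at
      most a multiple of \<open>N ^ 3\<close>; the two Walsh transforms dominate.\<close>
    have "k \<le> N" by (simp add: N_def less_imp_le)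
    have "N \<ge> 1" by (simp add: N_def)
    then have "N * 1 \<le> N * N" "N * N * 1 \<le> N * N * N"
      by (intro mult_le_mono2; simp)+
    moreover have "N * k \<le> N * N" "N * N * k \<le> N * N * N"
      using \<open>k \<le> N\<close> by (intro mult_le_mono2; simp)+
    moreover have "N * (N * (k * 51 + 61) + 41) = 51 * (N * N * k) + 61 * (N * N) + 41 * N"
      "N * (k * 51 + 71) = 51 * (N * k) + 71 * N"
      by (simp_all add: algebra_simps)
    ultimately show "(k * 31 + 18) + ((N * 51 + 8) + ((N * 51 + 8) +
      ((N * (N * (k * 51 + 61) + 41) + 8) + ((N * 51 + 50) + ((N * (N * (k * 51 + 61) + 41) + 8) +
      (N * (k * 51 + 71) + 20)))))) \<le> 900 * N ^ 3"
      using \<open>k \<le> N\<close> \<open>N \<ge> 1\<close> unfolding power3_eq_cube by linarith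
  qed
qed

text \<open>Each entry of \<open>V x - t\<close> is a row scale times a Hamming distance, so the
  \<open>p\<close>-th power of the norm is the given sum divided by \<open>Z\<close>: it is 1 for
  nonempty \<open>X\<close> and \<open>1 + 2 ^ k / Z\<close> for the origin.\<close>

lemma isolating_of_weights:
  fixes w :: "nat set \<Rightarrow> real" and p Z :: real and k :: nat
  defines "\<alpha> \<equiv> \<lambda>u. \<bar>w (set_decode u) / Z\<bar> powr (1 / p)"
  assumes p: "p > 0" and Z: "Z > 0" and w: "\<And>U. U \<subseteq> {..<k} \<Longrightarrow> w U \<ge> 0"
    and sum: "\<And>X. X \<subseteq> {..<k} \<Longrightarrow> (\<Sum>U\<in>Pow {..<k}. w U * real (card (sym_diff U X)) powr p)
        = Z + (if X = {} then 2 ^ k else 0)"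
  shows "isolating_parallelepiped p k
     (mat (2 ^ k) k (\<lambda>(u, j). \<alpha> u * (1 - 2 * real (u div 2 ^ j mod 2))))
     (vec (2 ^ k) (\<lambda>u. - (\<alpha> u * real (card (set_decode u)))))"
    (is "isolating_parallelepiped p k ?V ?t")
proof -
  have dec: "set_decode u \<subseteq> {..<k}" if "u < 2 ^ k" for u
    using bij_betw_imp_surj_on[OF bij_betw_set_decode[of k]] that by auto
  \<comment> \<open>Absolute values let this cover both \<open>t\<close>, whose entries are
    nonpositive, and \<open>V x - t\<close>.\<close>
  have norm: "lp_norm p y = (1 + (if X = {} then 2 ^ k else 0) / Z) powr (1 / p)"
    if y: "dim_vec y = 2 ^ k" "\<And>u. u < 2 ^ k \<Longrightarrow> \<bar>y $ u\<bar> = \<alpha> u * real (card (sym_diff (set_decode u) X))"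
      and X: "X \<subseteq> {..<k}" for y X
  proof -
    have "\<bar>y $ u\<bar> powr p = w (set_decode u) * real (card (sym_diff (set_decode u) X)) powr p / Z"
      if "u < 2 ^ k" for u
    proof -
      have "\<alpha> u powr p = w (set_decode u) / Z"
        using p Z w[OF dec[OF that]] by (simp add: \<alpha>_def powr_powr)
      then show ?thesis
        by (simp add: y(2)[OF that] powr_mult \<alpha>_def)
    qed
    then have "(\<Sum>u<2 ^ k. \<bar>y $ u\<bar> powr p)
        = (\<Sum>u<2 ^ k. w (set_decode u) * real (card (sym_diff (set_decode u) X)) powr p / Z)"
      by (intro sum.cong) auto
    also have "\<dots> = (\<Sum>U\<in>Pow {..<k}. w U * real (card (sym_diff U X)) powr p / Z)"
      by (rule sum.reindex_bij_betw[OF bij_betw_set_decode])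
    also have "\<dots> = 1 + (if X = {} then 2 ^ k else 0) / Z"
      using Z by (simp add: sum_divide_distrib[symmetric] sum[OF X] add_divide_distrib)
    finally show ?thesis
      by (simp only: lp_norm_def y(1))
  qed
  have "lp_norm p ?t = (1 + 2 ^ k / Z) powr (1 / p)"
    by (subst norm[where X = "{}"]) (auto simp: \<alpha>_def abs_mult)
  also have "\<dots> > 1 powr (1 / p)"
    using p Z by (intro powr_less_mono2) auto
  finally have "lp_norm p ?t > 1" by simp
  moreover have "lp_norm p (?V *\<^sub>v x - ?t) = 1" if x: "x \<in> zero_one_vecs k" "x \<noteq> 0\<^sub>v k" for x
  proof -
    define X where "X = {j. j < k \<and> x $ j = 1}"
    have xj: "x $ j = (if j \<in> X then 1 else 0)" if "j < k" for j
      using x(1) that by (auto simp: zero_one_vecs_def X_def)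
    have dim: "dim_vec x = k" using x(1) by (auto simp: zero_one_vecs_def)
    have "X \<noteq> {}"
    proof
      assume "X = {}"
      then have "x = 0\<^sub>v k" using xj dim by (intro eq_vecI) auto
      then show False using x(2) by simp
    qed
    have card: "real (card A) = (\<Sum>j<k. if j \<in> A then 1 else 0)" if "A \<subseteq> {..<k}" for A
      using that by (simp add: sum.If_cases Int_absorb1)
    \<comment> \<open>Coordinate \<open>j\<close> contributes \<open>1 - x_j\<close> if bit
      \<open>j\<close> of \<open>u\<close> is set and \<open>x_j\<close> otherwise, that is, 1
      exactly where the two sets differ.\<close>
    have "(?V *\<^sub>v x - ?t) $ u = \<alpha> u * real (card (sym_diff (set_decode u) X))" if u: "u < 2 ^ k" for u
    proof -
      have "(?V *\<^sub>v x - ?t) $ u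
          = (\<Sum>j<k. \<alpha> u * (1 - 2 * real (u div 2 ^ j mod 2)) * x $ j) + \<alpha> u * real (card (set_decode u))"
        using u dim by (simp add: scalar_prod_def lessThan_atLeast0)
      also have "\<dots> = \<alpha> u * (\<Sum>j<k. (1 - 2 * real (u div 2 ^ j mod 2)) * x $ j
          + (if j \<in> set_decode u then 1 else 0))"
        unfolding card[OF dec[OF u]] by (simp add: sum.distrib sum_subtractf sum_distrib_left algebra_simps)
      also have "(\<Sum>j<k. (1 - 2 * real (u div 2 ^ j mod 2)) * x $ j + (if j \<in> set_decode u then 1 else 0))
          = (\<Sum>j<k. if j \<in> sym_diff (set_decode u) X then 1 else 0)"
        by (intro sum.cong refl)
           (auto simp: xj set_decode_def odd_iff_mod_2_eq_one even_iff_mod_2_eq_zero)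
      also have "\<dots> = real (card (sym_diff (set_decode u) X))"
        by (rule card[symmetric]) (use dec[OF u] in \<open>auto simp: X_def\<close>)
      finally show ?thesis .
    qed
    then have "lp_norm p (?V *\<^sub>v x - ?t) = (1 + (if X = {} then 2 ^ k else 0) / Z) powr (1 / p)"
      by (intro norm) (auto simp: X_def \<alpha>_def)
    then show ?thesis using \<open>X \<noteq> {}\<close> by simp
  qed
  ultimately show ?thesis
    by (auto simp: isolating_parallelepiped_def)
qed

lemma isolating_walsh:
  assumes p: "p > 0" "\<forall>m<k. p \<noteq> real m" and k: "k > 0"
  shows "isolating_parallelepiped p k
     (mat (2 ^ k) k (\<lambda>(u, j). row_scale k p u * (1 - 2 * real (u div 2 ^ j mod 2))))
     (vec (2 ^ k) (\<lambda>u. - (row_scale k p u * real (card (set_decode u)))))"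
proof -
  define K where "K = {..<k}"
  note reindex = sum.reindex_bij_betw[OF bij_betw_set_decode[of k], folded K_def]
  define h where "h S = (\<Sum>U\<in>Pow K. (- 1) ^ card (S \<inter> U) * real (card U) powr p)" for S
  define y where "y S = (if S = {} then offset k p else 1 / h S)" for S
  define w where "w S = (\<Sum>U\<in>Pow K. (- 1) ^ card (S \<inter> U) * y U)" for S
  have H: "spectrum k p S = h (set_decode S)" for S
    unfolding spectrum_def walsh_def h_def
    by (rule reindex[of "\<lambda>U. (- 1) ^ card (set_decode S \<inter> U) * real (card U) powr p"])
  have "set_decode u = {} \<longleftrightarrow> u = 0" for u
    by (metis set_decode_inverse set_decode_zero)
  then have W: "weight k p S = w (set_decode S)" for S
    unfolding weight_def walsh_def w_def
    using reindex[of "\<lambda>U. (- 1) ^ card (set_decode S \<inter> U) * y U"] by (simp add: y_def H cong: if_cong)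
  have C: "offset k p = 1 + (\<Sum>U\<in>Pow K. \<bar>1 / h U\<bar>)"
    unfolding offset_def H by (simp only: reindex[of "\<lambda>U. \<bar>1 / h U\<bar>"])
  have fin: "finite K" by (simp add: K_def)
  \<comment> \<open>The alternating sum at \<open>x = 0\<close> with \<open>T = K - S\<close>; since
    \<open>card S \<le> k\<close>, it suffices to exclude the integers below
    \<open>k\<close>.\<close>
  have h_nonzero: "h S \<noteq> 0" if "S \<subseteq> K" for S
  proof -
    have "finite S" using that fin by (rule finite_subset)
    moreover have "card S \<le> k" using card_mono[OF fin that] by (simp add: K_def)
    moreover have "S \<union> (K - S) = K" using that by auto
    moreover have "K \<noteq> {}" using k by (auto simp: K_def)
    ultimately show ?thesis
      using alternating_powr_sum_nonzero[of S "K - S" p 0] p fin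
      by (simp add: h_def Int_commute)
  qed
  have "h {} > 0"
  proof -
    have "h {} \<ge> 0" by (simp add: h_def sum_nonneg)
    then show ?thesis using h_nonzero[of "{}"] by simp
  qed
  \<comment> \<open>\<open>offset\<close> is at least \<open>1 + 1 / h {}\<close>, so the left side
    is at least \<open>h {}\<close>.\<close>
  have Z: "offset k p * h {} - 1 > 0"
  proof -
    have "\<bar>1 / h {}\<bar> \<le> (\<Sum>U\<in>Pow K. \<bar>1 / h U\<bar>)"
      using fin by (intro member_le_sum) auto
    then have "(1 + 1 / h {}) * h {} \<le> offset k p * h {}"
      using \<open>h {} > 0\<close> by (intro mult_right_mono) (auto simp: C)
    moreover have "(1 + 1 / h {}) * h {} = h {} + 1"
      using \<open>h {} > 0\<close> by (simp add: field_simps)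
    ultimately show ?thesis using \<open>h {} > 0\<close> by linarith
  qed
  \<comment> \<open>The constant coefficient exceeds the sum of the absolute values of all other
    coefficients.\<close>
  have w_nonneg: "w U \<ge> 0" for U
  proof -
    have "w U = offset k p + (\<Sum>A\<in>Pow K - {{}}. (- 1) ^ card (U \<inter> A) * (1 / h A))"
      unfolding w_def using fin by (subst sum.remove[of _ "{}"]) (auto simp: y_def intro!: sum.cong)
    moreover have "\<bar>\<Sum>A\<in>Pow K - {{}}. (- 1) ^ card (U \<inter> A) * (1 / h A)\<bar>
        \<le> (\<Sum>A\<in>Pow K - {{}}. \<bar>1 / h A\<bar>)"
      by (rule order_trans[OF sum_abs]) (simp add: abs_mult power_abs)
    moreover have "\<dots> \<le> (\<Sum>A\<in>Pow K. \<bar>1 / h A\<bar>)"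
      using fin by (intro sum_mono2) auto
    ultimately show ?thesis using C by linarith
  qed
  have "(\<Sum>U\<in>Pow K. w U * real (card (sym_diff U X)) powr p)
      = offset k p * h {} - 1 + (if X = {} then 2 ^ k else 0)" if "X \<subseteq> K" for X
  proof -
    have "(\<Sum>U\<in>Pow K. w U * real (card (sym_diff U X)) powr p)
        = y {} * h {} - 1 + (if X = {} then 2 ^ card K else 0)"
      unfolding w_def by (rule walsh_weights[OF fin that]) (use h_nonzero in \<open>auto simp: h_def y_def\<close>)
    then show ?thesis by (simp add: y_def K_def)
  qed
  then show ?thesis
    unfolding row_scale_def W H set_decode_zero using p(1) Z w_nonneg
    by (intro isolating_of_weights) (auto simp: K_def)
qed

text \<open>The test comes before the numerical work, so failure depends only on whether
  \<open>p\<close> is an integer below \<open>k\<close>.\<close>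

definition prog :: com where
  "prog = Seq flag_prog (Cond (ILess (INat 0) (ivar 10)) Fail main_prog)"

lemma prog_Fail:
  assumes "\<exists>m<k. p = real m"
  shows "\<exists>n. exec prog (input_state k p) n None \<and> n \<le> k * 41 + 13"
proof -
  obtain n s where s: "exec flag_prog (input_state k p) n (Some s)" "n \<le> k * 41 + 8" "fst s 10 0 \<noteq> 0"
    using tot_flag_prog[of "input_state k p"] assms by (auto simp: input_state_def tot_def)
  have "exec (Cond (ILess (INat 0) (ivar 10)) Fail main_prog) s (bcost (ILess (INat 0) (ivar 10)) + 1) None"
    using s(3) by (intro exec.CondTrue exec.Fail) simp
  from exec.Seq[OF s(1) this] s(2) show ?thesis
    unfolding prog_def by fastforce
qed

lemma tot_prog:
  assumes p: "p > 0" "\<forall>m<k. p \<noteq> real m" and k: "k > 0"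
  shows "tot prog (input_state k p) (k * 41 + 12 + 900 * (2 ^ k) ^ 3)
    (\<lambda>s. isolating_parallelepiped p k (output_mat (2 ^ k) k s) (output_vec (2 ^ k) s))"
  unfolding prog_def
proof (rule tot_Seq)
  show "tot flag_prog (input_state k p) (k * 41 + 8) (\<lambda>s. frame {5, 10} {} (input_state k p) s \<and> fst s 10 0 = 0)"
    using tot_flag_prog[of "input_state k p"] p(2) by (auto simp: input_state_def elim!: tot_mono)
next
  fix s assume s: "frame {5, 10} {} (input_state k p) s \<and> fst s 10 0 = 0"
  then have in_s: "fst s 0 0 = k" "snd s 0 0 = p" "fst s 2 0 = 0" "fst s 3 0 = 0" "fst s 4 0 = 0"
    by (auto simp: frame_def input_state_def)
  show "tot (Cond (ILess (INat 0) (ivar 10)) Fail main_prog) s (4 + 900 * (2 ^ k) ^ 3)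
      (\<lambda>s. isolating_parallelepiped p k (output_mat (2 ^ k) k s) (output_vec (2 ^ k) s))"
  proof (rule tot_Cond[where ?B1.0 = "900 * (2 ^ k) ^ 3"])
    show "tot main_prog s (900 * (2 ^ k) ^ 3)
      (\<lambda>s. isolating_parallelepiped p k (output_mat (2 ^ k) k s) (output_vec (2 ^ k) s))"
    proof (rule tot_mono[OF tot_main_prog[OF in_s(3-5), unfolded in_s(1,2)] order_refl], goal_cases)
      case (1 s')
      then have "output_mat (2 ^ k) k s' =
          mat (2 ^ k) k (\<lambda>(u, j). row_scale k p u * (1 - 2 * real (u div 2 ^ j mod 2)))"
        "output_vec (2 ^ k) s' = vec (2 ^ k) (\<lambda>u. - (row_scale k p u * real (card (set_decode u))))"
        by (auto simp: output_mat_def output_vec_def)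
      then show ?case
        using isolating_walsh[OF assms] by simp
    qed
  qed (use s in auto)
qed simp

theorem theorem4p12:
  "\<exists>A. efficient A \<and>
     (\<forall>(k::nat) (p::real). k \<ge> 2 \<longrightarrow> p \<ge> 1 \<longrightarrow>
        fails_on A k p \<or>
        (\<exists>V t. outputs_on A k p V t \<and>
           V \<in> carrier_mat (2 ^ k) k \<and> t \<in> carrier_vec (2 ^ k) \<and>
           isolating_parallelepiped p k V t)) \<and>
     (\<forall>k::nat. k \<ge> 2 \<longrightarrow> finite {p::real. p \<ge> 1 \<and> fails_on A k p})"
proof (intro exI[of _ prog] conjI allI impI)
  show "efficient prog"
    unfolding efficient_def
  proof (rule exI[of _ 1000], rule exI[of _ 3], intro allI impI)
    fix k :: nat and p :: real assume kp: "2 \<le> k" "1 \<le> p"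
    have bound: "k * 41 + 13 + 900 * (2 ^ k) ^ 3 \<le> 1000 * (2 ^ k :: nat) ^ 3"
    proof -
      have "k \<le> 2 ^ k" "1 \<le> (2 :: nat) ^ k" by (simp_all add: less_imp_le)
      moreover have "(2 ^ k :: nat) \<le> (2 ^ k) ^ 3" by (rule self_le_power) auto
      ultimately show ?thesis by linarith
    qed
    show "\<exists>n r. exec prog (input_state k p) n r \<and> n \<le> 1000 * (2 ^ k) ^ 3"
    proof (cases "\<exists>m<k. p = real m")
      case True
      then obtain n where "exec prog (input_state k p) n None" "n \<le> k * 41 + 13"
        using prog_Fail by blast
      then show ?thesis
        using bound by (intro exI[of _ n] exI[of _ None]) simp
    next
      case False
      then obtain n s where "exec prog (input_state k p) n (Some s)"
        "n \<le> k * 41 + 12 + 900 * (2 ^ k) ^ 3"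
        using tot_prog[of p k] kp by (auto simp: tot_def)
      then show ?thesis
        using bound by (intro exI[of _ n] exI[of _ "Some s"]) simp
    qed
  qed
next
  fix k :: nat and p :: real assume kp: "2 \<le> k" "1 \<le> p"
  show "fails_on prog k p \<or> (\<exists>V t. outputs_on prog k p V t \<and>
           V \<in> carrier_mat (2 ^ k) k \<and> t \<in> carrier_vec (2 ^ k) \<and> isolating_parallelepiped p k V t)"
  proof (cases "\<exists>m<k. p = real m")
    case True
    then show ?thesis using prog_Fail[OF True] by (auto simp: fails_on_def)
  next
    case False
    then obtain n s where "exec prog (input_state k p) n (Some s)"
      "isolating_parallelepiped p k (output_mat (2 ^ k) k s) (output_vec (2 ^ k) s)"
      using tot_prog[of p k] kp by (auto simp: tot_def)
    moreover have "output_mat (2 ^ k) k s \<in> carrier_mat (2 ^ k) k" "output_vec (2 ^ k) s \<in> carrier_vec (2 ^ k)"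
      by (simp_all add: output_mat_def output_vec_def)
    ultimately show ?thesis unfolding outputs_on_def by blast
  qed
next
  fix k :: nat assume k: "2 \<le> k"
  \<comment> \<open>For any other \<open>p\<close> there is a normally ending run, which by
    determinism excludes a failing one.\<close>
  have "\<exists>m<k. p = real m" if "1 \<le> p" "fails_on prog k p" for p
  proof (rule ccontr)
    assume "\<not> (\<exists>m<k. p = real m)"
    then obtain n s where "exec prog (input_state k p) n (Some s)"
      using tot_prog[of p k] k \<open>1 \<le> p\<close> by (auto simp: tot_def)
    then show False
      using that(2) exec_deterministic unfolding fails_on_def by blast
  qed
  then have "{p. 1 \<le> p \<and> fails_on prog k p} \<subseteq> real ` {..<k}" by auto
  then show "finite {p. 1 \<le> p \<and> fails_on prog k p}"
    by (rule finite_subset) simp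
qed

end
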